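(* Let $m>1$ and for $i\in\{1,\dots,m\}$ let $A_i\in\mathbb{R}^{n_i\times n}$, $b_i\in\mathbb{R}^{n_i}$; let $A$ and $b$ be the matrices obtained by stacking $A_1,\dots,A_m$ and $b_1,\dots,b_m$ respectively. Suppose that $Ax=b$ has a unique solution $x^*\in\mathbb{R}^n$. Let $\mathbb{N}(1),\mathbb{N}(2),\dots$ be a sequence of directed graphs on the vertex set $\{1,\dots,m\}$, each having self-arcs at all vertices, and suppose that each agent $i$ updates its state $x_i(t)\in\mathbb{R}^n$ according to $$x_i(t+1)=x_i(t)-\frac{1}{m_i(t)}P_i\Big(m_i(t)x_i(t)-\sum_{j\in\mathcal{N}_i(t)}x_j(t)\Big),\qquad i\in\{1,\dots,m\},$$ where each state is initialized at a solution of agent $i$'s own equation $A_ix=b_i$. Then there exists a nonnegative constant $\lambda<1$ for which all $x_i(t)$ converge to the unique solution $x^*$ of $Ax=b$ as $t\to\infty$ at the same rate as $\lambda^t$ converges to $0$ if and only if the sequence of neighbor graphs $\mathbb{N}(1),\mathbb{N}(2),\dots$ is repeatedly jointly $\mathcal{D}$-connected.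
   Context: $P_i$ is the orthogonal projection of $\mathbb{R}^n$ onto $\ker A_i$, and $\mathcal{P}_i=\ker A_i$ is its column span. In a directed graph, vertex $j$ is a neighbor of vertex $i$ if $(j,i)$ (an arc from $j$ to $i$) is an arc. $\mathcal{N}_i(t)$ is the set of neighbors of $i$ in $\mathbb{N}(t)$ (it contains $i$) and $m_i(t)$ is its cardinality. Meaning of the convergence rate: convergence is exponential in the sense of (uniform) exponential stability of linear time-varying systems: there exist $c>0$ and $\lambda\in[0,1)$ such that for every starting time $t_0\ge 1$ and all initial states $x_1(t_0),\dots,x_m(t_0)$ with $A_ix_i(t_0)=b_i$ for all $i$, the iteration run from time $t_0$ satisfies $\max_i|x_i(t)-x^*|\le c\,\lambda^{t-t_0}\max_i|x_i(t_0)-x^*|$ for all $t\ge t_0$ (with $0^0=1$). $\mathcal{D}$-connectivity: let $\mathcal{V}=\{1,\dots,m\}$. A nonempty subset $\mathcal{E}\subset\mathcal{V}$ is partially populated if $\bigcap_{i\in\mathcal{V}}\mathcal{P}_i$ is a proper subset of $\bigcap_{i\in\mathcal{E}}\mathcal{P}_i$. $\mathcal{D}$ is the collection of all partially populated subsets of $\mathcal{V}$. A directed graph $\mathbb{G}$ on $\mathcal{V}$ is $\mathcal{D}$-connected if for every $\mathcal{E}\in\mathcal{D}$ there are $i\in\mathcal{E}$ and $j\in\mathcal{V}\setminus\mathcal{E}$ such that $(j,i)$ is an arc of $\mathbb{G}$. The composition $\mathbb{G}_q\circ\mathbb{G}_p$ of directed graphs on $\mathcal{V}$ is the directed graph on $\mathcal{V}$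 in which $(i,j)$ is an arc iff there is a $k$ with $(i,k)$ an arc of $\mathbb{G}_p$ and $(k,j)$ an arc of $\mathbb{G}_q$. A finite sequence $\mathbb{G}_1,\dots,\mathbb{G}_q$ is jointly $\mathcal{D}$-connected if $\mathbb{G}_q\circ\cdots\circ\mathbb{G}_1$ is $\mathcal{D}$-connected. An infinite sequence $\mathbb{G}_1,\mathbb{G}_2,\dots$ is repeatedly jointly $\mathcal{D}$-connected if there are positive integers $l,\tau_0$ such that for every integer $k\ge0$ the finite sequence $\mathbb{G}_{\tau_0+kl},\dots,\mathbb{G}_{\tau_0+(k+1)l-1}$ is jointly $\mathcal{D}$-connected. *)

theory Defs
  imports "HOL-Analysis.Analysis"
begin

text \<open>
  The agents are \<open>1, \<dots>, m\<close> and states live in \<open>real ^ 'n\<close>. As the number of rows \<open>n\<^sub>i\<close> of \<open>A\<^sub>i\<close>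
  depends on the agent, it cannot be a type: a matrix with \<open>n\<close> columns is represented by the list
  of its rows, and a vector of matching height by a list of reals.
\<close>

type_synonym 'n row_mat = "(real ^ 'n) list"

definition row_mat_vec :: "'n::finite row_mat \<Rightarrow> real ^ 'n \<Rightarrow> real list"
  where "row_mat_vec A x = map (\<lambda>r. r \<bullet> x) A"

definition row_mat_kernel :: "'n::finite row_mat \<Rightarrow> (real ^ 'n) set"
  where "row_mat_kernel A = {x. row_mat_vec A x = replicate (length A) 0}"

text \<open>Stacking of row matrices, and likewise of right-hand sides.\<close>

definition stack :: "nat \<Rightarrow> (nat \<Rightarrow> 'a list) \<Rightarrow> 'a list"
  where "stack m B = concat (map B [1..<m+1])"

definition is_orth_proj :: "(real ^ 'n) set \<Rightarrow> real ^ 'n ^ 'n::finite \<Rightarrow> bool"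
  where "is_orth_proj S P \<longleftrightarrow> (\<forall>x. P *v x \<in> S \<and> (\<forall>y\<in>S. orthogonal (x - P *v x) y))"

definition orth_proj :: "(real ^ 'n) set \<Rightarrow> real ^ 'n ^ 'n::finite"
  where "orth_proj S = (THE P. is_orth_proj S P)"

lemma ex1_orth_proj:
  fixes S :: "(real ^ 'n::finite) set"
  assumes S: "subspace S"
  shows "\<exists>!P. is_orth_proj S P"
proof -
  have uniq: "u = v"
    if "u \<in> S" "v \<in> S" "\<forall>y\<in>S. orthogonal (x - u) y" "\<forall>y\<in>S. orthogonal (x - v) y" for x u v
  proof -
    have "u - v \<in> S"
      using that S by (simp add: subspace_diff)
    then have "(x - v) \<bullet> (u - v) = 0" "(x - u) \<bullet> (u - v) = 0"
      using that by (auto simp: orthogonal_def)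
    then have "(u - v) \<bullet> (u - v) = 0"
      by (simp add: inner_diff_left)
    then show ?thesis by simp
  qed
  have "\<forall>x. \<exists>p. p \<in> S \<and> (\<forall>y\<in>S. orthogonal (x - p) y)"
  proof
    fix x
    obtain y z where "y \<in> span S" "\<And>w. w \<in> span S \<Longrightarrow> orthogonal z w" "x = y + z"
      using orthogonal_subspace_decomp_exists by blast
    moreover have "span S = S"
      using S by (simp add: span_eq_iff)
    ultimately show "\<exists>p. p \<in> S \<and> (\<forall>y\<in>S. orthogonal (x - p) y)"
      by (intro exI[of _ y]) auto
  qed
  from choice[OF this] obtain p
    where p: "\<And>x. p x \<in> S" "\<And>x y. y \<in> S \<Longrightarrow> orthogonal (x - p x) y"
    by blast
  have ip: "p x \<bullet> y = x \<bullet> y" if "y \<in> S" for x y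
    using p(2)[OF that, of x] by (simp add: orthogonal_def inner_diff_left)
  have "linear p"
  proof (rule linearI)
    fix x y
    show "p (x + y) = p x + p y"
      by (rule uniq[of _ _ "x + y"])
        (simp_all add: S p subspace_add orthogonal_def inner_diff_left inner_add_left ip)
  next
    fix c x
    show "p (c *\<^sub>R x) = c *\<^sub>R p x"
      by (rule uniq[of _ _ "c *\<^sub>R x"])
        (simp_all add: S p subspace_scale orthogonal_def inner_diff_left ip)
  qed
  then have "is_orth_proj S (matrix p)"
    using p by (simp add: is_orth_proj_def matrix_works)
  moreover have "P = Q" if "is_orth_proj S P" "is_orth_proj S Q" for P Q
  proof -
    have "P *v x = Q *v x" for x
      by (rule uniq[of _ _ x]) (use that in \<open>auto simp: is_orth_proj_def\<close>)
    then show ?thesis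
      by (simp add: matrix_eq)
  qed
  ultimately show ?thesis by blast
qed

lemma is_orth_proj_orth_proj: "subspace S \<Longrightarrow> is_orth_proj S (orth_proj S)"
  unfolding orth_proj_def by (rule theI') (rule ex1_orth_proj)

lemma subspace_row_mat_kernel: "subspace (row_mat_kernel A)"
  by (auto simp: row_mat_kernel_def row_mat_vec_def subspace_def list_eq_iff_nth_eq inner_add_right)

text \<open>
  A directed graph on \<open>{1..m}\<close> is given by its set of arcs, where \<open>(j, i)\<close> is the arc from \<open>j\<close>
  to \<open>i\<close>.
\<close>

type_synonym digraph = "(nat \<times> nat) set"

definition digraph_on :: "nat \<Rightarrow> digraph \<Rightarrow> bool"
  where "digraph_on m G \<longleftrightarrow> G \<subseteq> {1..m} \<times> {1..m}"

definition self_arcs :: "nat \<Rightarrow> digraph \<Rightarrow> bool"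
  where "self_arcs m G \<longleftrightarrow> (\<forall>i\<in>{1..m}. (i, i) \<in> G)"

definition neighbors :: "digraph \<Rightarrow> nat \<Rightarrow> nat set"
  where "neighbors G i = {j. (j, i) \<in> G}"

text \<open>Relation composition runs in diagram order: \<open>G\<^sub>q \<circ> \<dots> \<circ> G\<^sub>1\<close> is \<open>G\<^sub>1 O \<dots> O G\<^sub>q\<close>.\<close>

definition graph_comp :: "digraph \<Rightarrow> digraph \<Rightarrow> digraph"
  where "graph_comp Gq Gp = Gp O Gq"

text \<open>Intended for nonempty lists \<open>[G\<^sub>1, \<dots>, G\<^sub>q]\<close> only.\<close>

definition graph_comp_list :: "digraph list \<Rightarrow> digraph"
  where "graph_comp_list Gs = foldl (\<lambda>C G. graph_comp G C) (hd Gs) (tl Gs)"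

text \<open>In the following, \<open>K i\<close> is the subspace associated with agent \<open>i\<close>.\<close>

definition partially_populated :: "nat \<Rightarrow> (nat \<Rightarrow> 'v set) \<Rightarrow> nat set \<Rightarrow> bool"
  where "partially_populated m K E \<longleftrightarrow>
    E \<subseteq> {1..m} \<and> E \<noteq> {} \<and> (\<Inter>i\<in>{1..m}. K i) \<subset> (\<Inter>i\<in>E. K i)"

definition D_connected :: "nat \<Rightarrow> (nat \<Rightarrow> 'v set) \<Rightarrow> digraph \<Rightarrow> bool"
  where "D_connected m K G \<longleftrightarrow>
    (\<forall>E. partially_populated m K E \<longrightarrow> (\<exists>i\<in>E. \<exists>j\<in>{1..m} - E. (j, i) \<in> G))"

definition jointly_D_connected :: "nat \<Rightarrow> (nat \<Rightarrow> 'v set) \<Rightarrow> digraph list \<Rightarrow> bool"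
  where "jointly_D_connected m K Gs \<longleftrightarrow> D_connected m K (graph_comp_list Gs)"

text \<open>Sequences of graphs start at time 1; the value at index 0 is never used.\<close>

definition repeatedly_jointly_D_connected ::
    "nat \<Rightarrow> (nat \<Rightarrow> 'v set) \<Rightarrow> (nat \<Rightarrow> digraph) \<Rightarrow> bool"
  where "repeatedly_jointly_D_connected m K N \<longleftrightarrow>
    (\<exists>l \<tau>\<^sub>0. l > 0 \<and> \<tau>\<^sub>0 > 0 \<and>
      (\<forall>k. jointly_D_connected m K (map N [\<tau>\<^sub>0 + k * l ..< \<tau>\<^sub>0 + (k + 1) * l])))"

text \<open>
  \<open>x i t\<close> is the state of agent \<open>i\<close> at time \<open>t\<close>; the iteration is run from time \<open>t\<^sub>0\<close>, each agent
  starting at a solution of its own equation.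
\<close>

definition trajectory ::
    "nat \<Rightarrow> (nat \<Rightarrow> 'n::finite row_mat) \<Rightarrow> (nat \<Rightarrow> real list) \<Rightarrow> (nat \<Rightarrow> digraph) \<Rightarrow>
      nat \<Rightarrow> (nat \<Rightarrow> nat \<Rightarrow> real ^ 'n) \<Rightarrow> bool"
  where "trajectory m A b N t\<^sub>0 x \<longleftrightarrow>
    (\<forall>i\<in>{1..m}. row_mat_vec (A i) (x i t\<^sub>0) = b i) \<and>
    (\<forall>t\<ge>t\<^sub>0. \<forall>i\<in>{1..m}.
      x i (t + 1) = x i t - (1 / real (card (neighbors (N t) i))) *\<^sub>R
        (orth_proj (row_mat_kernel (A i)) *v
          (real (card (neighbors (N t) i)) *\<^sub>R x i t - (\<Sum>j\<in>neighbors (N t) i. x j t))))"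

text \<open>
  Convergence at the same rate as \<open>lam\<^sup>t\<close>, in the sense of uniform exponential stability: the
  constant \<open>c\<close> depends neither on the starting time nor on the initial states.
\<close>

definition converges_at_rate ::
    "nat \<Rightarrow> (nat \<Rightarrow> 'n::finite row_mat) \<Rightarrow> (nat \<Rightarrow> real list) \<Rightarrow> (nat \<Rightarrow> digraph) \<Rightarrow>
      real ^ 'n \<Rightarrow> real \<Rightarrow> bool"
  where "converges_at_rate m A b N xs lam \<longleftrightarrow>
    (\<exists>c>0. \<forall>t\<^sub>0\<ge>1. \<forall>x. trajectory m A b N t\<^sub>0 x \<longrightarrow>
      (\<forall>t\<ge>t\<^sub>0. (MAX i\<in>{1..m}. norm (x i t - xs))
                \<le> c * lam ^ (t - t\<^sub>0) * (MAX i\<in>{1..m}. norm (x i t\<^sub>0 - xs))))"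

end

theory Submission
  imports Defs
begin

text \<open>
  In terms of the errors \<open>y\<^sub>i = x\<^sub>i - xs\<close> the iteration is linear and homogeneous: since
  \<open>y\<^sub>i\<close> lies in \<open>K\<^sub>i = ker A\<^sub>i\<close>, agent \<open>i\<close> replaces \<open>y\<^sub>i\<close> by the projection onto \<open>K\<^sub>i\<close> of
  the average of its neighbors' errors (\<open>trajectory_iff\<close>). Neither averaging nor projecting
  increases the largest error norm. Uniqueness of the solution says that the \<open>K\<^sub>i\<close> intersect
  in 0, so a nonempty set \<open>E\<close> of agents is partially populated exactly if its agents can share a nonzero
  error.

  If a window of graphs is not jointly D-connected, some such \<open>E\<close> receives no arc from outside
  during the window. Starting with a common nonzero error in \<open>E\<close> and error 0 elsewhere, the
  agents in \<open>E\<close> do not move during the window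
  (\<open>not_D_connected_imp_stationary_error\<close>). At rate \<open>lam\<close> with constant \<open>c\<close> this is
  impossible for windows of length \<open>l\<close> with \<open>c * lam ^ l < 1\<close>; hence convergence forces all
  windows of that length to be jointly D-connected.

  Conversely, let all errors have norm at most 1 and suppose that agent \<open>i\<close> still has an error
  \<open>v\<close> of norm 1 after some steps. Equality in the projection and averaging estimates holds only
  if all neighbors of \<open>i\<close>, including \<open>i\<close> itself, already had the error \<open>v\<close> one step earlier.
  So, going back in time, the set of agents with error \<open>v\<close> only grows, and as it is partially
  populated it gains a member in every jointly D-connected window (\<open>card_extremal_less\<close>).
  This cannot happen \<open>m\<close> times, so any period that contains \<open>m\<close> such windows strictly
  decreases the largest error norm (\<open>windows_strict_contraction\<close>). Because the error vectors of
  norm at most 1 form a compact set and only finitely many graph sequences of a given length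
  exist, one factor below 1 serves all starting times (\<open>uniform_contraction_of_strict\<close>), and
  iterating over consecutive periods gives the exponential rate (\<open>exponential_decay\<close>).
\<close>

section \<open>Averages and decay\<close>

lemma norm_average_le:
  fixes y :: "'b \<Rightarrow> 'v::real_normed_vector"
  assumes "\<And>j. j \<in> S \<Longrightarrow> norm (y j) \<le> B" and "0 \<le> B"
  shows "norm ((1 / real (card S)) *\<^sub>R (\<Sum>j\<in>S. y j)) \<le> B"
proof (cases "card S = 0")
  case False
  have "norm (\<Sum>j\<in>S. y j) \<le> real (card S) * B"
    using sum_norm_bound[of S y B] assms by simp
  then show ?thesis
    using False by (simp add: field_simps)
qed (use assms in simp)

text \<open>
  Strict convexity of the Euclidean ball: the squared deviations from the average add up to
  \<open>\<Sum>|y\<^sub>j|\<^sup>2 - card S * |a|\<^sup>2\<close>, which is at most 0 when no \<open>y\<^sub>j\<close> is longer than the average \<open>a\<close>.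
\<close>

lemma average_extremal_imp_constant:
  fixes y :: "'b \<Rightarrow> 'v::real_inner"
  assumes "finite S" and a: "a = (1 / real (card S)) *\<^sub>R (\<Sum>j\<in>S. y j)"
    and le: "\<And>j. j \<in> S \<Longrightarrow> norm (y j) \<le> norm a" and "j \<in> S"
  shows "y j = a"
proof -
  have "card S \<noteq> 0"
    using assms by auto
  then have sum: "(\<Sum>j\<in>S. y j) = real (card S) *\<^sub>R a"
    by (simp add: a)
  have expand: "(norm (y k - a))\<^sup>2 = (norm (y k))\<^sup>2 - 2 * (y k \<bullet> a) + (norm a)\<^sup>2" for k
    by (simp add: power2_norm_eq_inner inner_diff_left inner_diff_right inner_commute)
  have "(\<Sum>k\<in>S. (norm (y k - a))\<^sup>2)
      = (\<Sum>k\<in>S. (norm (y k))\<^sup>2) - 2 * ((\<Sum>k\<in>S. y k) \<bullet> a) + real (card S) * (norm a)\<^sup>2"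
    unfolding expand by (simp add: sum.distrib sum_subtractf inner_sum_left sum_distrib_left)
  also have "\<dots> = (\<Sum>k\<in>S. (norm (y k))\<^sup>2) - real (card S) * (norm a)\<^sup>2"
    by (simp add: sum power2_norm_eq_inner)
  also have "\<dots> \<le> 0"
    using sum_bounded_above[of S "\<lambda>k. (norm (y k))\<^sup>2" "(norm a)\<^sup>2"] le
    by (simp add: power_mono)
  finally have "(\<Sum>k\<in>S. (norm (y k - a))\<^sup>2) = 0"
    by (simp add: antisym sum_nonneg)
  then have "(norm (y j - a))\<^sup>2 = 0"
    using \<open>finite S\<close> \<open>j \<in> S\<close> by (simp add: sum_nonneg_eq_0_iff)
  then show ?thesis by simp
qed

text \<open>
  Turns a contraction by \<open>\<rho>\<close> per \<open>T\<close> steps into a rate per step. The factor \<open>1 / \<rho>\<close> pays for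
  the incomplete last period of fewer than \<open>T\<close> steps.
\<close>

lemma power_div_le_root_power:
  fixes \<rho> :: real
  assumes "0 < \<rho>" "\<rho> < 1" "0 < T"
  shows "\<rho> ^ (s div T) \<le> (1 / \<rho>) * root T \<rho> ^ s"
proof -
  define \<mu> where "\<mu> = root T \<rho>"
  have \<mu>: "\<mu> ^ T = \<rho>" "0 < \<mu>" "\<mu> \<le> 1"
    using assms by (simp_all add: \<mu>_def)
  have "\<mu> ^ s = \<mu> ^ (T * (s div T) + s mod T)"
    by simp
  also have "\<dots> = \<rho> ^ (s div T) * \<mu> ^ (s mod T)"
    by (simp only: power_add power_mult \<mu>(1))
  finally have split: "\<mu> ^ s = \<rho> ^ (s div T) * \<mu> ^ (s mod T)" .
  have "\<mu> ^ T \<le> \<mu> ^ (s mod T)"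
    using \<mu> assms by (intro power_decreasing) (auto intro: less_imp_le)
  then have "\<rho> ^ (s div T) * \<rho> \<le> \<mu> ^ s"
    unfolding split using \<mu> assms by (intro mult_left_mono) auto
  then show ?thesis
    using assms by (simp add: \<mu>_def field_simps)
qed

section \<open>Composition of graphs with self-arcs\<close>

lemma graph_comp_list_singleton [simp]: "graph_comp_list [G] = G"
  by (simp add: graph_comp_list_def)

lemma graph_comp_list_snoc:
  "Gs \<noteq> [] \<Longrightarrow> graph_comp_list (Gs @ [G]) = graph_comp_list Gs O G"
  by (simp add: graph_comp_list_def graph_comp_def)

lemma self_arcs_graph_comp_list:
  assumes "Gs \<noteq> []" "\<forall>G\<in>set Gs. self_arcs m G"
  shows "self_arcs m (graph_comp_list Gs)"
  using assms
proof (induction Gs rule: rev_nonempty_induct)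
  case (snoc G Gs)
  then show ?case
    by (auto simp: graph_comp_list_snoc self_arcs_def intro!: relcompI)
qed simp

text \<open>
  Waiting at its endpoints along self-arcs extends an arc of any one factor to an arc of the
  composition, so arcs missing from the composition are missing from every factor.
\<close>

lemma subset_graph_comp_list:
  assumes "\<forall>G\<in>set Gs. digraph_on m G \<and> self_arcs m G" and "G \<in> set Gs"
  shows "G \<subseteq> graph_comp_list Gs"
  using assms
proof (induction Gs rule: rev_induct)
  case (snoc H Gs)
  show ?case
  proof (cases "Gs = []")
    case True
    then show ?thesis
      using snoc.prems by simp
  next
    case False
    have refl: "self_arcs m (graph_comp_list Gs)"
      using snoc.prems False by (intro self_arcs_graph_comp_list) auto
    show ?thesis
    proof (cases "G = H")
      case True
      then show ?thesis
        using refl snoc.prems False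
        by (fastforce simp: graph_comp_list_snoc self_arcs_def digraph_on_def)
    next
      case G: False
      then have "G \<subseteq> graph_comp_list Gs" "digraph_on m G" "self_arcs m H"
        using snoc by auto
      then show ?thesis
        using False by (fastforce simp: graph_comp_list_snoc self_arcs_def digraph_on_def)
    qed
  qed
qed simp

lemma finite_neighbors: "digraph_on m G \<Longrightarrow> finite (neighbors G i)"
  by (rule finite_subset[of _ "{1..m}"]) (auto simp: neighbors_def digraph_on_def)

section \<open>Projected averaging\<close>

text \<open>
  All that matters about the equations is the family of subspaces \<open>K i = ker A\<^sub>i\<close> with its
  orthogonal projections. \<open>Inter_K\<close> expresses that the stacked system has at most one solution.
\<close>

locale projected_averaging =
  fixes m :: nat and K :: "nat \<Rightarrow> 'v::euclidean_space set" and P :: "nat \<Rightarrow> 'v \<Rightarrow> 'v"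
  assumes subspace_K: "subspace (K i)"
    and linear_P: "linear (P i)"
    and P_in: "P i x \<in> K i"
    and P_orthogonal: "y \<in> K i \<Longrightarrow> orthogonal (x - P i x) y"
    and Inter_K: "(\<Inter>i\<in>{1..m}. K i) = {0}"
begin

lemma P_fixes:
  assumes "x \<in> K i"
  shows "P i x = x"
proof -
  have "x - P i x \<in> K i"
    using assms P_in subspace_K by (simp add: subspace_diff)
  then have "orthogonal (x - P i x) (x - P i x)"
    by (rule P_orthogonal)
  then show ?thesis
    by (simp add: orthogonal_self)
qed

lemma P_scale_diff: "x \<in> K i \<Longrightarrow> P i (c *\<^sub>R x - w) = c *\<^sub>R x - P i w"
  by (simp only: linear_diff[OF linear_P] linear_scale[OF linear_P] P_fixes)

lemma norm_P_pythagoras: "(norm x)\<^sup>2 = (norm (P i x))\<^sup>2 + (norm (x - P i x))\<^sup>2"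
proof -
  have "orthogonal (P i x) (x - P i x)"
    using P_orthogonal[OF P_in] by (simp add: orthogonal_commute)
  from norm_add_Pythagorean[OF this] show ?thesis
    by simp
qed

lemma norm_P_le: "norm (P i x) \<le> norm x"
proof (rule power2_le_imp_le)
  show "(norm (P i x))\<^sup>2 \<le> (norm x)\<^sup>2"
    unfolding norm_P_pythagoras[of x i] by simp
qed simp

lemma P_eq_if_norm_le:
  assumes "norm x \<le> norm (P i x)"
  shows "P i x = x"
proof -
  have "(norm x)\<^sup>2 \<le> (norm (P i x))\<^sup>2"
    using assms by (simp add: power_mono)
  then have "(norm (x - P i x))\<^sup>2 \<le> 0"
    using norm_P_pythagoras[of x i] by linarith
  then show ?thesis
    by simp
qed

text \<open>
  The value 0 outside \<open>{1..m}\<close> makes the error dynamics an equation between functions and the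
  norm balls of states compact in the product topology.
\<close>

definition states :: "(nat \<Rightarrow> 'v) set"
  where "states = {y. (\<forall>i\<in>{1..m}. y i \<in> K i) \<and> (\<forall>i. i \<notin> {1..m} \<longrightarrow> y i = 0)}"

definition ball_states :: "real \<Rightarrow> (nat \<Rightarrow> 'v) set"
  where "ball_states B = {y \<in> states. \<forall>i. norm (y i) \<le> B}"

definition step :: "digraph \<Rightarrow> (nat \<Rightarrow> 'v) \<Rightarrow> nat \<Rightarrow> 'v"
  where "step G y i = P i ((1 / real (card (neighbors G i))) *\<^sub>R (\<Sum>j\<in>neighbors G i. y j))"

abbreviation run :: "digraph list \<Rightarrow> (nat \<Rightarrow> 'v) \<Rightarrow> nat \<Rightarrow> 'v"
  where "run \<equiv> fold step"

lemma ball_states_mono: "y \<in> ball_states B \<Longrightarrow> B \<le> C \<Longrightarrow> y \<in> ball_states C"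
  unfolding ball_states_def by (blast intro: order_trans)

lemma ball_states_nonneg: "y \<in> ball_states B \<Longrightarrow> 0 \<le> B"
  unfolding ball_states_def by (blast intro: order_trans[OF norm_ge_zero])

lemma step_states:
  assumes "digraph_on m G"
  shows "step G y \<in> states"
proof -
  have "neighbors G i = {}" if "i \<notin> {1..m}" for i
    using assms that by (auto simp: neighbors_def digraph_on_def)
  then show ?thesis
    using linear_0[OF linear_P] by (auto simp: states_def step_def P_in)
qed

lemma step_ball_states:
  assumes "digraph_on m G" and y: "y \<in> ball_states B"
  shows "step G y \<in> ball_states B"
proof -
  have le: "norm (y i) \<le> B" for i
    using y by (simp add: ball_states_def)
  moreover have "0 \<le> B"
    using y by (rule ball_states_nonneg)
  ultimately have "norm (step G y i) \<le> B" for i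
    unfolding step_def by (intro order_trans[OF norm_P_le] norm_average_le)
  then show ?thesis
    using assms by (simp add: ball_states_def step_states)
qed

lemma run_ball_states:
  "\<forall>G\<in>set Gs. digraph_on m G \<Longrightarrow> y \<in> ball_states B \<Longrightarrow> run Gs y \<in> ball_states B"
  by (induction Gs arbitrary: y) (simp_all add: step_ball_states)

lemma step_scale: "step G (\<lambda>i. c *\<^sub>R y i) = (\<lambda>i. c *\<^sub>R step G y i)"
  by (simp add: step_def fun_eq_iff linear_scale[OF linear_P] flip: scaleR_sum_right)

lemma run_scale: "run Gs (\<lambda>i. c *\<^sub>R y i) = (\<lambda>i. c *\<^sub>R run Gs y i)"
  by (induction Gs arbitrary: y) (simp_all add: step_scale)

lemma continuous_on_step: "continuous_on UNIV (step G)"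
proof (rule continuous_on_coordinatewise_then_product)
  fix i
  let ?avg = "\<lambda>y :: nat \<Rightarrow> 'v. (1 / real (card (neighbors G i))) *\<^sub>R (\<Sum>j\<in>neighbors G i. y j)"
  have "continuous_on UNIV ?avg"
    by (intro continuous_on_scaleR continuous_on_const continuous_on_sum) simp
  moreover have "continuous_on UNIV (P i)"
    using linear_P by (intro linear_continuous_on) (simp add: linear_conv_bounded_linear)
  ultimately show "continuous_on UNIV (\<lambda>y. step G y i)"
    unfolding step_def by (metis continuous_on_compose2 subset_UNIV)
qed

lemma continuous_on_run: "continuous_on UNIV (run Gs)"
proof (induction Gs)
  case Nil
  show ?case
    by (simp add: id_def continuous_on_id)
next
  case (Cons G Gs)
  then show ?case
    using continuous_on_compose2[OF Cons continuous_on_step[of G]]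
    by (simp add: o_def)
qed

lemma compact_ball_states: "compact (ball_states B)"
proof -
  define C where "C i = (if i \<in> {1..m} then K i \<inter> cball 0 B else {0} \<inter> cball 0 B)" for i
  have "ball_states B = Pi\<^sub>E UNIV C"
    by (force simp: ball_states_def states_def C_def PiE_def Pi_def)
  moreover have "compact (C i)" for i
    using closed_subspace[OF subspace_K[of i]] by (auto simp: C_def closed_Int_compact)
  ultimately show ?thesis
    using compactin_PiE[of "\<lambda>_. euclidean" UNIV C]
    by (simp add: euclidean_product_topology)
qed

section \<open>Errors of extremal norm\<close>

text \<open>
  A projected average of vectors in the unit ball has norm 1 only if the projection does not
  shorten the average, hence fixes it, and the average itself has norm 1, which by strict
  convexity makes all averaged vectors equal.
\<close>

lemma step_extremal:
  assumes G: "digraph_on m G" and y: "y \<in> ball_states 1"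
    and one: "norm (step G y i) = 1" and j: "(j, i) \<in> G"
  shows "y j = step G y i"
proof -
  define a where "a = (1 / real (card (neighbors G i))) *\<^sub>R (\<Sum>j\<in>neighbors G i. y j)"
  have y1: "norm (y k) \<le> 1" for k
    using y by (simp add: ball_states_def)
  have "norm a \<le> 1"
    unfolding a_def by (rule norm_average_le) (use y1 in auto)
  moreover have Pa: "step G y i = P i a"
    by (simp add: step_def a_def)
  ultimately have Pa_a: "P i a = a"
    using one P_eq_if_norm_le[of a i] by simp
  then have a1: "norm a = 1"
    using one Pa by simp
  have "y j = a"
  proof (rule average_extremal_imp_constant[OF finite_neighbors[OF G] a_def])
    show "norm (y k) \<le> norm a" for k
      using y1 a1 by simp
    show "j \<in> neighbors G i"
      using j by (simp add: neighbors_def)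
  qed
  also have "a = step G y i"
    by (simp only: Pa Pa_a)
  finally show ?thesis .
qed

text \<open>
  The arcs of the composed graph are the paths along which \<open>step_extremal\<close> can be iterated
  backwards.
\<close>

lemma run_extremal:
  assumes "Gs \<noteq> []" "\<forall>G\<in>set Gs. digraph_on m G" and "y \<in> ball_states 1"
    and "norm (run Gs y i) = 1" and "(j, i) \<in> graph_comp_list Gs"
  shows "y j = run Gs y i"
  using assms
proof (induction Gs arbitrary: i rule: rev_nonempty_induct)
  case (single G)
  then show ?case
    using step_extremal[of G y i j] by simp
next
  case (snoc G Gs)
  obtain k where k: "(j, k) \<in> graph_comp_list Gs" "(k, i) \<in> G"
    using snoc.prems snoc.hyps by (auto simp: graph_comp_list_snoc)
  have z: "run (Gs @ [G]) y i = step G (run Gs y) i"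
    by simp
  have Gs: "\<forall>G\<in>set Gs. digraph_on m G" and G: "digraph_on m G"
    using snoc.prems(1) by auto
  have y: "y \<in> ball_states 1"
    by (rule snoc.prems(2))
  have k': "run Gs y k = run (Gs @ [G]) y i"
    unfolding z
    by (rule step_extremal[OF G run_ball_states[OF Gs y] _ k(2)]) (use snoc.prems(3) z in simp)
  then have "norm (run Gs y k) = 1"
    using snoc.prems(3) by (simp only:)
  from snoc.IH[OF Gs y this k(1)] k' show ?case
    by (rule trans)
qed

text \<open>
  Let \<open>E\<close> be the set of agents with error \<open>v\<close> at the end of a window. All of them had it at the
  start as well, by self-arcs. As \<open>v\<close> is a nonzero vector common to the subspaces of \<open>E\<close>, the
  set \<open>E\<close> is partially populated, so D-connectivity supplies an arc into \<open>E\<close> from an agent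
  outside \<open>E\<close>, which had the error \<open>v\<close> at the start too.
\<close>

lemma card_extremal_less:
  assumes ne: "Gs \<noteq> []" and Gs: "\<forall>G\<in>set Gs. digraph_on m G \<and> self_arcs m G"
    and conn: "D_connected m K (graph_comp_list Gs)" and y: "y \<in> ball_states 1"
    and v: "norm v = 1" and ex: "\<exists>i\<in>{1..m}. run Gs y i = v"
  shows "card {i\<in>{1..m}. run Gs y i = v} < card {i\<in>{1..m}. y i = v}"
proof (rule psubset_card_mono)
  let ?E = "{i\<in>{1..m}. run Gs y i = v}"
  have G: "\<forall>G\<in>set Gs. digraph_on m G"
    using Gs by blast
  have preimage: "y j = v" if "i \<in> ?E" "(j, i) \<in> graph_comp_list Gs" for i j
    using run_extremal[OF ne G y _ that(2)] that(1) v by simp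
  have "run Gs y \<in> states"
    using run_ball_states[OF G y] by (simp add: ball_states_def)
  then have "v \<in> (\<Inter>i\<in>?E. K i)"
    unfolding states_def by blast
  moreover have "v \<noteq> 0"
    using v by force
  moreover have "0 \<in> (\<Inter>i\<in>?E. K i)"
    using subspace_0[OF subspace_K] by blast
  ultimately have "{0} \<subset> (\<Inter>i\<in>?E. K i)"
    by blast
  moreover have "?E \<subseteq> {1..m}" "?E \<noteq> {}"
    using ex by auto
  ultimately have "partially_populated m K ?E"
    unfolding partially_populated_def Inter_K by simp
  then obtain i j where ij: "i \<in> ?E" "j \<in> {1..m} - ?E" "(j, i) \<in> graph_comp_list Gs"
    using conn unfolding D_connected_def by blast
  have "self_arcs m (graph_comp_list Gs)"
    using ne Gs by (intro self_arcs_graph_comp_list) auto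
  then have "?E \<subseteq> {i\<in>{1..m}. y i = v}"
    using preimage unfolding self_arcs_def by blast
  moreover have "j \<in> {i\<in>{1..m}. y i = v}"
    using ij preimage by blast
  ultimately show "?E \<subset> {i\<in>{1..m}. y i = v}"
    using ij by blast
qed simp

section \<open>Uniform contraction\<close>

lemma run_append_interval:
  assumes "s \<le> t" "t \<le> u"
  shows "run (map N [s..<u]) y = run (map N [t..<u]) (run (map N [s..<t]) y)"
proof -
  have "[s..<u] = [s..<t] @ [t..<u]"
    using upt_add_eq_append[of s t "u - t"] assms by simp
  then show ?thesis
    by simp
qed

context
  fixes N :: "nat \<Rightarrow> digraph"
  assumes N_on: "\<And>t. t \<ge> 1 \<Longrightarrow> digraph_on m (N t)"
    and N_self: "\<And>t. t \<ge> 1 \<Longrightarrow> self_arcs m (N t)"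
begin

lemma run_interval_ball_states:
  "1 \<le> s \<Longrightarrow> y \<in> ball_states B \<Longrightarrow> run (map N [s..<t]) y \<in> ball_states B"
  by (rule run_ball_states) (auto intro: N_on)

lemma card_extremal_windows:
  assumes "0 < l" "1 \<le> a"
    and "\<And>j. jointly_D_connected m K (map N [a + j * l..<a + (j + 1) * l])"
    and "y \<in> ball_states 1" "norm v = 1" "\<exists>i\<in>{1..m}. run (map N [a..<a + q * l]) y i = v"
  shows "q < card {i\<in>{1..m}. y i = v}"
  using assms(2-)
proof (induction q arbitrary: a y)
  case 0
  then show ?case
    by (auto simp: card_gt_0_iff)
next
  case (Suc q)
  let ?z = "run (map N [a..<a + l]) y"
  have split: "run (map N [a..<a + Suc q * l]) y = run (map N [a + l..<a + l + q * l]) ?z"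
    using run_append_interval[of a "a + l" "a + Suc q * l" N y] by (simp add: algebra_simps)
  have q: "q < card {i\<in>{1..m}. ?z i = v}"
  proof (rule Suc.IH)
    show "jointly_D_connected m K (map N [a + l + j * l..<a + l + (j + 1) * l])" for j
      using Suc.prems(2)[of "j + 1"] by (simp add: algebra_simps)
  qed (use Suc.prems split run_interval_ball_states in \<open>auto simp: algebra_simps\<close>)
  then have "{i\<in>{1..m}. ?z i = v} \<noteq> {}"
    by (metis card.empty not_less_zero)
  moreover have "D_connected m K (graph_comp_list (map N [a..<a + l]))"
    using Suc.prems(2)[of 0] by (simp add: jointly_D_connected_def)
  ultimately have "card {i\<in>{1..m}. ?z i = v} < card {i\<in>{1..m}. y i = v}"
    using Suc.prems N_on N_self \<open>0 < l\<close> by (intro card_extremal_less) auto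
  then show ?case
    using q by simp
qed

text \<open>
  The period length \<open>\<tau> + l + m * l\<close> leaves room, from any starting time on, to wait for the
  beginning of a window and then to pass through \<open>m\<close> full windows. An error of norm 1 surviving
  the period would, by \<open>card_extremal_windows\<close>, be shared by more than \<open>m\<close> agents.
\<close>

lemma windows_strict_contraction:
  assumes l: "0 < l"
    and conn: "\<And>k. jointly_D_connected m K (map N [\<tau> + k * l..<\<tau> + (k + 1) * l])"
    and t: "1 \<le> t" and y: "y \<in> ball_states 1"
  shows "norm (run (map N [t..<t + (\<tau> + l + m * l)]) y i) < 1"
proof (rule ccontr)
  let ?u = "t + (\<tau> + l + m * l)"
  let ?z = "run (map N [t..<?u]) y"
  assume "\<not> norm (?z i) < 1"
  moreover have z: "?z \<in> ball_states 1"
    using t y by (rule run_interval_ball_states)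
  ultimately have v: "norm (?z i) = 1"
    by (simp add: ball_states_def antisym not_less)
  then have i: "i \<in> {1..m}"
    using z by (auto simp: ball_states_def states_def)
  \<comment> \<open>Window \<open>k\<close>, starting at time \<open>a\<close>, begins at or after \<open>t\<close>; truncated subtraction covers \<open>t < \<tau>\<close>.\<close>
  define k where "k = (t - \<tau>) div l + 1"
  define a where "a = \<tau> + k * l"
  have "(t - \<tau>) div l * l \<le> t - \<tau>" "t - \<tau> < l + (t - \<tau>) div l * l"
    using div_times_less_eq_dividend dividend_less_div_times[OF l] by blast+
  then have "(t - \<tau>) div l * l \<le> t" "t \<le> \<tau> + l + (t - \<tau>) div l * l"
    by linarith+
  then have a: "t \<le> a" "a + m * l \<le> ?u"
    by (auto simp: a_def k_def algebra_simps)
  let ?w = "run (map N [t..<a]) y"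
  let ?x = "run (map N [a..<a + m * l]) ?w"
  have w: "?w \<in> ball_states 1" and x: "?x \<in> ball_states 1"
    using t y a by (auto intro!: run_interval_ball_states)
  have "?z = run (map N [a..<?u]) ?w"
    using a by (intro run_append_interval) auto
  also have "\<dots> = run (map N [a + m * l..<?u]) ?x"
    using a by (intro run_append_interval) auto
  finally have z_x: "?z = run (map N [a + m * l..<?u]) ?x" .
  \<comment> \<open>The error of norm 1 is pulled back from the end of the period to the end of the last window.\<close>
  have xv: "?x i = ?z i"
  proof (cases "a + m * l = ?u")
    case False
    then have ne: "map N [a + m * l..<?u] \<noteq> []"
      using a t by simp
    have "self_arcs m (graph_comp_list (map N [a + m * l..<?u]))"
      using a t by (intro self_arcs_graph_comp_list[OF ne]) (auto intro: N_self)
    then show ?thesis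
      using run_extremal[OF ne _ x, of i i] v i a t N_on
      by (auto simp: self_arcs_def z_x)
  qed (use z_x in simp)
  have "m < card {j\<in>{1..m}. ?w j = ?z i}"
  proof (rule card_extremal_windows[OF l, where a = a])
    show "jointly_D_connected m K (map N [a + j * l..<a + (j + 1) * l])" for j
      using conn[of "k + j"] by (simp add: a_def algebra_simps)
  qed (use a t w v i xv in auto)
  moreover have "card {j\<in>{1..m}. ?w j = ?z i} \<le> card {1..m}"
    by (intro card_mono) auto
  ultimately show False
    by simp
qed

end

text \<open>
  For each graph sequence and agent, the norm of the final error is a continuous function on the
  compact set of states with norms at most 1; there it attains its maximum, which is therefore
  below 1. The largest of these finitely many maxima serves as factor, and homogeneity extends
  the estimate to states of any size.
\<close>

lemma uniform_contraction_of_strict: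
  assumes "finite F"
    and strict: "\<And>Gs y i. Gs \<in> F \<Longrightarrow> y \<in> ball_states 1 \<Longrightarrow> norm (run Gs y i) < 1"
    and F: "\<And>Gs. Gs \<in> F \<Longrightarrow> \<forall>G\<in>set Gs. digraph_on m G"
  shows "\<exists>\<rho>. 0 < \<rho> \<and> \<rho> < 1 \<and>
    (\<forall>Gs\<in>F. \<forall>B. \<forall>y\<in>ball_states B. run Gs y \<in> ball_states (\<rho> * B))"
proof -
  have "(\<lambda>_. 0) \<in> ball_states 1"
    using subspace_0[OF subspace_K] by (simp add: ball_states_def states_def)
  then have ne: "ball_states 1 \<noteq> {}"
    by blast
  have "\<exists>c<1. \<forall>y\<in>ball_states 1. norm (run Gs y i) \<le> c" if "Gs \<in> F" for Gs i
  proof -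
    have "continuous_on (ball_states 1) (\<lambda>y. norm (run Gs y i))"
      by (rule continuous_on_norm[OF continuous_on_product_then_coordinatewise
            [OF continuous_on_subset[OF continuous_on_run subset_UNIV]]])
    from continuous_attains_sup[OF compact_ball_states ne this] obtain z
      where "z \<in> ball_states 1" "\<forall>y\<in>ball_states 1. norm (run Gs y i) \<le> norm (run Gs z i)"
      by blast
    then show ?thesis
      using strict[OF that, of z i] by (intro exI[of _ "norm (run Gs z i)"] conjI)
  qed
  then have "\<forall>Gs\<in>F. \<forall>i. \<exists>c<1. \<forall>y\<in>ball_states 1. norm (run Gs y i) \<le> c"
    by blast
  then obtain c where "\<forall>Gs\<in>F. \<forall>i. c Gs i < 1 \<and> (\<forall>y\<in>ball_states 1. norm (run Gs y i) \<le> c Gs i)"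
    unfolding bchoice_iff choice_iff by blast
  then have c: "c Gs i < 1" "y \<in> ball_states 1 \<Longrightarrow> norm (run Gs y i) \<le> c Gs i"
    if "Gs \<in> F" for Gs i y
    using that by blast+
  \<comment> \<open>Including 1/2 keeps the factor positive and the set nonempty.\<close>
  define \<rho> where "\<rho> = Max (insert (1/2) ((\<lambda>(Gs, i). c Gs i) ` (F \<times> {1..m})))"
  have fin: "finite ((\<lambda>(Gs, i). c Gs i) ` (F \<times> {1..m}))"
    using \<open>finite F\<close> by simp
  have "1/2 \<le> \<rho>"
    unfolding \<rho>_def by (rule Max_ge) (use fin in simp_all)
  moreover have "\<rho> < 1"
    unfolding \<rho>_def using fin c(1) by (subst Max_less_iff) auto
  ultimately have \<rho>: "1/2 \<le> \<rho>" "\<rho> < 1" .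
  have c_le: "c Gs i \<le> \<rho>" if "Gs \<in> F" "i \<in> {1..m}" for Gs i
    unfolding \<rho>_def using fin that by (intro Max_ge) auto
  have "run Gs y \<in> ball_states (\<rho> * B)" if Gs: "Gs \<in> F" and y: "y \<in> ball_states B" for Gs B y
  proof -
    have run: "run Gs y \<in> ball_states B"
      using y F[OF Gs] by (intro run_ball_states) auto
    have "0 \<le> B"
      using y by (rule ball_states_nonneg)
    have "norm (run Gs y i) \<le> \<rho> * B" for i
    proof (cases "i \<in> {1..m} \<and> B \<noteq> 0")
      case True
      then have B: "0 < B"
        using \<open>0 \<le> B\<close> by simp
      have "(1 / B) *\<^sub>R y j \<in> K j" if "j \<in> {1..m}" for j
        using y that by (intro subspace_scale[OF subspace_K]) (simp add: ball_states_def states_def)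
      then have "(\<lambda>i. (1 / B) *\<^sub>R y i) \<in> ball_states 1"
        using y B by (simp add: ball_states_def states_def)
      then have "norm (run Gs (\<lambda>i. (1 / B) *\<^sub>R y i) i) \<le> c Gs i"
        by (rule c(2)[OF Gs])
      also have "\<dots> \<le> \<rho>"
        using c_le[OF Gs] True by simp
      finally have "norm (run Gs (\<lambda>i. (1 / B) *\<^sub>R y i) i) \<le> \<rho>" .
      then show ?thesis
        using B by (simp add: run_scale divide_le_eq)
    next
      case False
      have "norm (run Gs y i) \<le> B" "i \<notin> {1..m} \<Longrightarrow> run Gs y i = 0"
        using run by (simp_all add: ball_states_def states_def)
      then have "norm (run Gs y i) \<le> 0"
        using False by (cases "i \<in> {1..m}") simp_all
      also have "0 \<le> \<rho> * B"
        using \<rho> \<open>0 \<le> B\<close> by simp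
      finally show ?thesis .
    qed
    then show ?thesis
      using run by (simp add: ball_states_def)
  qed
  then show ?thesis
    using \<rho> by (intro exI[of _ \<rho>] conjI ballI allI) simp_all
qed

text \<open>
  A graph on \<open>{1..m}\<close> is one of finitely many sets of arcs, so the periods of the fixed length \<open>T\<close>
  starting at the various times realise only finitely many graph sequences. This makes the
  contraction factor, and with it \<open>c\<close> and \<open>lam\<close>, independent of the starting time.
\<close>

lemma exponential_decay:
  assumes N_on: "\<And>t. t \<ge> 1 \<Longrightarrow> digraph_on m (N t)"
    and N_self: "\<And>t. t \<ge> 1 \<Longrightarrow> self_arcs m (N t)"
    and "repeatedly_jointly_D_connected m K N"
  shows "\<exists>c>0. \<exists>lam. 0 \<le> lam \<and> lam < 1 \<and> (\<forall>t\<^sub>0\<ge>1. \<forall>t\<ge>t\<^sub>0. \<forall>B. \<forall>y\<in>ball_states B.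
    run (map N [t\<^sub>0..<t]) y \<in> ball_states (c * lam ^ (t - t\<^sub>0) * B))"
proof -
  obtain l \<tau> where l: "0 < l"
    and conn: "\<And>k. jointly_D_connected m K (map N [\<tau> + k * l..<\<tau> + (k + 1) * l])"
    using assms(3) unfolding repeatedly_jointly_D_connected_def by blast
  define T where "T = \<tau> + l + m * l"
  have T: "0 < T"
    using l by (simp add: T_def)
  define F where "F = (\<lambda>t. map N [t..<t + T]) ` {1..}"
  have "N s \<in> Pow ({1..m} \<times> {1..m})" if "1 \<le> s" for s
    using N_on[OF that] by (simp only: digraph_on_def Pow_iff)
  then have N_Pow: "N ` {t..<t + T} \<subseteq> Pow ({1..m} \<times> {1..m})" if "1 \<le> t" for t
    using that by (meson atLeastLessThan_iff image_subsetI order_trans)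
  have "F \<subseteq> {Gs. set Gs \<subseteq> Pow ({1..m} \<times> {1..m}) \<and> length Gs = T}"
    unfolding F_def using N_Pow by (intro image_subsetI) (simp del: One_nat_def)
  then have "finite F"
    by (rule finite_subset) (simp add: finite_lists_length_eq)
  moreover have "\<And>Gs y i. Gs \<in> F \<Longrightarrow> y \<in> ball_states 1 \<Longrightarrow> norm (run Gs y i) < 1"
    using windows_strict_contraction[OF N_on N_self l conn] by (auto simp: F_def T_def)
  moreover have "\<And>Gs. Gs \<in> F \<Longrightarrow> \<forall>G\<in>set Gs. digraph_on m G"
    using N_on by (auto simp: F_def)
  ultimately obtain \<rho> where \<rho>: "0 < \<rho>" "\<rho> < 1"
    and contr: "\<And>Gs B y. Gs \<in> F \<Longrightarrow> y \<in> ball_states B \<Longrightarrow> run Gs y \<in> ball_states (\<rho> * B)"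
    using uniform_contraction_of_strict[of F] by blast
  have blocks: "run (map N [t..<t + q * T]) y \<in> ball_states (\<rho> ^ q * B)"
    if "1 \<le> t" "y \<in> ball_states B" for t q y B
  proof (induction q)
    case (Suc q)
    let ?z = "run (map N [t..<t + q * T]) y"
    have "run (map N [t..<t + Suc q * T]) y
        = run (map N [t + q * T..<t + q * T + T]) ?z"
      using run_append_interval[of t "t + q * T" "t + Suc q * T" N y] by (simp add: algebra_simps)
    also have "\<dots> \<in> ball_states (\<rho> * (\<rho> ^ q * B))"
      using that Suc by (intro contr) (auto simp: F_def)
    finally show ?case
      by (simp add: mult.assoc)
  qed (use that in simp)
  have "run (map N [t\<^sub>0..<t]) y \<in> ball_states ((1 / \<rho>) * root T \<rho> ^ (t - t\<^sub>0) * B)"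
    if t: "1 \<le> t\<^sub>0" "t\<^sub>0 \<le> t" and y: "y \<in> ball_states B" for t\<^sub>0 t B y
  proof -
    define q where "q = (t - t\<^sub>0) div T"
    have "q * T \<le> t - t\<^sub>0"
      by (simp add: q_def)
    then have "run (map N [t\<^sub>0..<t]) y
        = run (map N [t\<^sub>0 + q * T..<t]) (run (map N [t\<^sub>0..<t\<^sub>0 + q * T]) y)"
      using t by (intro run_append_interval) auto
    also have "\<dots> \<in> ball_states (\<rho> ^ q * B)"
      using t y N_on by (intro run_ball_states blocks) auto
    finally have run: "run (map N [t\<^sub>0..<t]) y \<in> ball_states (\<rho> ^ q * B)" .
    have "0 \<le> B"
      using y by (rule ball_states_nonneg)
    then have "\<rho> ^ q * B \<le> (1 / \<rho>) * root T \<rho> ^ (t - t\<^sub>0) * B"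
      unfolding q_def using power_div_le_root_power[OF \<rho> T] by (intro mult_right_mono)
    from run this show ?thesis
      by (rule ball_states_mono)
  qed
  moreover have "0 \<le> root T \<rho>" "root T \<rho> < 1" "0 < 1 / \<rho>"
    using \<rho> T by simp_all
  ultimately show ?thesis
    by (intro exI[of _ "1 / \<rho>"] conjI exI[of _ "root T \<rho>"]) simp_all
qed

section \<open>Stationary errors\<close>

text \<open>
  An agent of a set \<open>E\<close> that is closed under taking neighbors averages only copies of \<open>v\<close>, and its
  projection fixes \<open>v\<close>.
\<close>

lemma run_closed_set:
  assumes "\<forall>G\<in>set Gs. digraph_on m G \<and> self_arcs m G"
    and "\<forall>G\<in>set Gs. \<forall>i\<in>E. neighbors G i \<subseteq> E"
    and "E \<subseteq> {1..m}" and v: "\<And>i. i \<in> E \<Longrightarrow> v \<in> K i"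
    and "\<forall>i\<in>E. y i = v"
  shows "\<forall>i\<in>E. run Gs y i = v"
  using assms(1,2,5)
proof (induction Gs arbitrary: y)
  case (Cons G Gs)
  have "step G y i = v" if "i \<in> E" for i
  proof -
    have nb: "neighbors G i \<subseteq> E"
      using Cons.prems(2) that by simp
    have G: "digraph_on m G" "self_arcs m G"
      using Cons.prems(1) by simp_all
    have "i \<in> neighbors G i"
      using G(2) that \<open>E \<subseteq> {1..m}\<close> unfolding neighbors_def self_arcs_def by blast
    then have card: "card (neighbors G i) \<noteq> 0"
      using finite_neighbors[OF G(1), of i] by auto
    have "(\<Sum>j\<in>neighbors G i. y j) = (\<Sum>j\<in>neighbors G i. v)"
      using Cons.prems(3) nb by (intro sum.cong) auto
    then have "step G y i = P i v"
      unfolding step_def sum_constant_scaleR using card by simp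
    then show ?thesis
      using P_fixes[OF v[OF that]] by (rule trans)
  qed
  then have "\<forall>i\<in>E. step G y i = v"
    by blast
  moreover have "\<forall>G\<in>set Gs. digraph_on m G \<and> self_arcs m G"
    "\<forall>G\<in>set Gs. \<forall>i\<in>E. neighbors G i \<subseteq> E"
    using Cons.prems(1,2) by simp_all
  ultimately show ?case
    using Cons.IH[of "step G y"] by simp
qed simp

text \<open>
  A set \<open>E\<close> violating D-connectivity of the composition has no incoming arcs in any of the graphs.
  The witness \<open>y\<close> is a nonzero common vector of the subspaces of \<open>E\<close> on \<open>E\<close>, and 0 elsewhere.
\<close>

lemma not_D_connected_imp_stationary_error:
  assumes Gs: "\<forall>G\<in>set Gs. digraph_on m G \<and> self_arcs m G"
    and "\<not> D_connected m K (graph_comp_list Gs)"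
  obtains y v i where "v \<noteq> 0" "y \<in> ball_states (norm v)" "i \<in> {1..m}" "run Gs y i = v"
proof -
  obtain E where E: "partially_populated m K E"
    and closed: "\<And>i j. i \<in> E \<Longrightarrow> j \<in> {1..m} - E \<Longrightarrow> (j, i) \<notin> graph_comp_list Gs"
    using assms(2) unfolding D_connected_def by blast
  obtain v where "v \<in> (\<Inter>i\<in>E. K i)" and v0: "v \<noteq> 0"
    using E unfolding partially_populated_def Inter_K by blast
  then have v: "v \<in> K i" if "i \<in> E" for i
    using that by blast
  have EV: "E \<subseteq> {1..m}" "E \<noteq> {}"
    using E by (auto simp: partially_populated_def)
  have "\<forall>G\<in>set Gs. \<forall>i\<in>E. neighbors G i \<subseteq> E"
  proof (intro ballI subsetI)
    fix G i j
    assume G: "G \<in> set Gs" and i: "i \<in> E" and "j \<in> neighbors G i"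
    then have ji: "(j, i) \<in> G"
      by (simp add: neighbors_def)
    then have "(j, i) \<in> graph_comp_list Gs"
      using subset_graph_comp_list[OF Gs G] by blast
    moreover have "j \<in> {1..m}"
      using Gs G ji unfolding digraph_on_def by blast
    ultimately show "j \<in> E"
      using closed[OF i] by blast
  qed
  moreover define y where "y i = (if i \<in> E then v else 0)" for i
  ultimately have "\<forall>i\<in>E. run Gs y i = v"
    using run_closed_set[OF Gs _ EV(1) v] by simp
  moreover have "y i \<in> K i" for i
    using v subspace_0[OF subspace_K] by (simp add: y_def)
  then have "y \<in> ball_states (norm v)"
    using EV(1) by (auto simp: ball_states_def states_def y_def)
  ultimately show ?thesis
    using that[OF v0] EV by blast
qed

end

section \<open>Distributed linear equations\<close>

lemma row_mat_vec_stack_eq_iff: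
  assumes "\<forall>i\<in>{1..m}. length (A i) = length (b i)"
  shows "row_mat_vec (stack m A) x = stack m b \<longleftrightarrow> (\<forall>i\<in>{1..m}. row_mat_vec (A i) x = b i)"
proof -
  have "row_mat_vec (stack m A) x = concat (map (\<lambda>i. row_mat_vec (A i) x) [1..<m+1])"
    by (simp add: row_mat_vec_def stack_def map_concat o_def)
  also have "\<dots> = stack m b \<longleftrightarrow> map (\<lambda>i. row_mat_vec (A i) x) [1..<m+1] = map b [1..<m+1]"
    unfolding stack_def using assms
    by (intro concat_eq_concat_iff) (auto simp: set_zip row_mat_vec_def simp del: upt_Suc)
  also have "\<dots> \<longleftrightarrow> (\<forall>i\<in>{1..m}. row_mat_vec (A i) x = b i)"
    by (auto simp del: upt_Suc)
  finally show ?thesis .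
qed

lemma row_mat_vec_eq_iff_diff_kernel:
  assumes "row_mat_vec B xs = c"
  shows "row_mat_vec B x = c \<longleftrightarrow> x - xs \<in> row_mat_kernel B"
  using assms[symmetric]
  by (auto simp: row_mat_vec_def row_mat_kernel_def list_eq_iff_nth_eq inner_diff_right)

lemma inter_kernels_trivial:
  assumes len: "\<forall>i\<in>{1..m}. length (A i) = length (b i)"
    and uniq: "\<exists>!x. row_mat_vec (stack m A) x = stack m b"
    and sol: "\<forall>i\<in>{1..m}. row_mat_vec (A i) xs = b i"
  shows "(\<Inter>i\<in>{1..m}. row_mat_kernel (A i)) = {0}"
proof -
  have "v = 0" if v: "v \<in> (\<Inter>i\<in>{1..m}. row_mat_kernel (A i))" for v
  proof -
    have "row_mat_vec (A i) (xs + v) = b i" if i: "i \<in> {1..m}" for i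
      using row_mat_vec_eq_iff_diff_kernel[OF sol[rule_format, OF i], of "xs + v"] v i by simp
    then have "row_mat_vec (stack m A) (xs + v) = stack m b"
      "row_mat_vec (stack m A) xs = stack m b"
      using sol unfolding row_mat_vec_stack_eq_iff[OF len] by blast+
    then have "xs + v = xs"
      using uniq by blast
    then show ?thesis
      by simp
  qed
  then show ?thesis
    using subspace_0[OF subspace_row_mat_kernel] by blast
qed

locale distributed_system =
  fixes m :: nat and A :: "nat \<Rightarrow> 'n::finite row_mat" and b :: "nat \<Rightarrow> real list"
    and xs :: "real ^ 'n" and N :: "nat \<Rightarrow> digraph"
  assumes m: "m > 1"
    and len: "\<forall>i\<in>{1..m}. length (A i) = length (b i)"
    and unique: "\<exists>!x. row_mat_vec (stack m A) x = stack m b"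
    and stack_sol: "row_mat_vec (stack m A) xs = stack m b"
    and N_on: "\<And>t. t \<ge> 1 \<Longrightarrow> digraph_on m (N t)"
    and N_self: "\<And>t. t \<ge> 1 \<Longrightarrow> self_arcs m (N t)"
begin

abbreviation kern :: "nat \<Rightarrow> (real ^ 'n) set"
  where "kern i \<equiv> row_mat_kernel (A i)"

definition proj :: "nat \<Rightarrow> real ^ 'n \<Rightarrow> real ^ 'n"
  where "proj i x = orth_proj (kern i) *v x"

lemma sol: "\<forall>i\<in>{1..m}. row_mat_vec (A i) xs = b i"
  using stack_sol unfolding row_mat_vec_stack_eq_iff[OF len] .

sublocale projected_averaging m kern proj
proof (rule projected_averaging.intro)
  have "is_orth_proj (kern i) (orth_proj (kern i))" for i
    by (intro is_orth_proj_orth_proj subspace_row_mat_kernel)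
  then show "proj i x \<in> kern i" "y \<in> kern i \<Longrightarrow> orthogonal (x - proj i x) y" for i x y
    unfolding is_orth_proj_def proj_def by blast+
  show "linear (proj i)" for i
    unfolding proj_def by simp
  show "(\<Inter>i\<in>{1..m}. kern i) = {0}"
    by (rule inter_kernels_trivial[OF len unique sol])
qed (rule subspace_row_mat_kernel)

definition err :: "(nat \<Rightarrow> nat \<Rightarrow> real ^ 'n) \<Rightarrow> nat \<Rightarrow> nat \<Rightarrow> real ^ 'n"
  where "err x t = (\<lambda>i. if i \<in> {1..m} then x i t - xs else 0)"

text \<open>
  Since \<open>x\<^sub>i - xs\<close> is fixed by the projection of agent \<open>i\<close>, it cancels from the update rule and
  only the projected average remains. This uses that the error stays in the kernels, so that the
  equivalence is shown for one time step under that hypothesis and then carried along the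
  trajectory.
\<close>

lemma trajectory_iff:
  assumes "1 \<le> t\<^sub>0"
  shows "trajectory m A b N t\<^sub>0 x \<longleftrightarrow>
    err x t\<^sub>0 \<in> states \<and> (\<forall>t\<ge>t\<^sub>0. err x (t + 1) = step (N t) (err x t))"
proof -
  let ?eq = "\<lambda>i t. x i (t + 1) = x i t - (1 / real (card (neighbors (N t) i))) *\<^sub>R
      (orth_proj (row_mat_kernel (A i)) *v
        (real (card (neighbors (N t) i)) *\<^sub>R x i t - (\<Sum>j\<in>neighbors (N t) i. x j t)))"
  have init: "(\<forall>i\<in>{1..m}. row_mat_vec (A i) (x i t\<^sub>0) = b i) \<longleftrightarrow> err x t\<^sub>0 \<in> states"
    using row_mat_vec_eq_iff_diff_kernel[OF sol[rule_format]]
    by (auto simp: states_def err_def)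
  have one_agent: "?eq i t \<longleftrightarrow> err x (t + 1) i = step (N t) (err x t) i"
    if t: "1 \<le> t" and st: "err x t \<in> states" and i: "i \<in> {1..m}" for t i
  proof -
    define S where "S = neighbors (N t) i"
    have S: "finite S" "S \<subseteq> {1..m}" "i \<in> S"
      using N_on[OF t] N_self[OF t] i finite_neighbors
      by (auto simp: S_def neighbors_def digraph_on_def self_arcs_def)
    then have card: "card S \<noteq> 0"
      by auto
    have yi: "x i t - xs \<in> kern i"
      using st i by (auto simp: states_def err_def)
    have "(\<Sum>j\<in>S. err x t j) = (\<Sum>j\<in>S. x j t - xs)"
      using S by (intro sum.cong) (auto simp: err_def)
    then have "real (card S) *\<^sub>R x i t - (\<Sum>j\<in>S. x j t)
        = real (card S) *\<^sub>R (x i t - xs) - (\<Sum>j\<in>S. err x t j)"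
      by (simp add: sum_subtractf sum_constant_scaleR scaleR_diff_right del: sum_constant)
    then have eq: "proj i (real (card S) *\<^sub>R x i t - (\<Sum>j\<in>S. x j t))
        = real (card S) *\<^sub>R (x i t - xs) - proj i (\<Sum>j\<in>S. err x t j)"
      by (simp only: P_scale_diff[OF yi])
    have "x i t - (1 / real (card S)) *\<^sub>R proj i (real (card S) *\<^sub>R x i t - (\<Sum>j\<in>S. x j t))
        = xs + step (N t) (err x t) i"
      unfolding eq step_def S_def[symmetric] linear_scale[OF linear_P]
      using card by (simp add: scaleR_diff_right)
    then show ?thesis
      using i by (auto simp: err_def S_def proj_def algebra_simps)
  qed
  have all_agents: "(\<forall>i\<in>{1..m}. ?eq i t) \<longleftrightarrow> err x (t + 1) = step (N t) (err x t)"
    if t: "1 \<le> t" and st: "err x t \<in> states" for t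
  proof -
    have "err x (t + 1) i = step (N t) (err x t) i" if "i \<notin> {1..m}" for i
      using that step_states[OF N_on[OF t], of "err x t"] by (auto simp: states_def err_def)
    then show ?thesis
      using one_agent[OF t st] by (auto simp: fun_eq_iff)
  qed
  have st: "err x t \<in> states"
    if "err x t\<^sub>0 \<in> states" "t\<^sub>0 \<le> t" and "\<And>t. t\<^sub>0 \<le> t \<Longrightarrow> err x t \<in> states \<Longrightarrow>
      err x (t + 1) = step (N t) (err x t)" for t
    using \<open>t\<^sub>0 \<le> t\<close>
  proof (induction t rule: dec_induct)
    case (step t)
    then show ?case
      using that(3)[of t] step_states[OF N_on, of t] \<open>1 \<le> t\<^sub>0\<close> by simp
  qed (use that in simp)
  have "trajectory m A b N t\<^sub>0 x \<longleftrightarrow> err x t\<^sub>0 \<in> states \<and> (\<forall>t\<ge>t\<^sub>0. \<forall>i\<in>{1..m}. ?eq i t)"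
    unfolding trajectory_def init ..
  also have "\<dots> \<longleftrightarrow>
      err x t\<^sub>0 \<in> states \<and> (\<forall>t\<ge>t\<^sub>0. err x (t + 1) = step (N t) (err x t))"
    using st all_agents \<open>1 \<le> t\<^sub>0\<close> order_trans by meson
  finally show ?thesis .
qed

lemma trajectory_imp_err_run:
  assumes "1 \<le> t\<^sub>0" "trajectory m A b N t\<^sub>0 x" "t\<^sub>0 \<le> t"
  shows "err x t = run (map N [t\<^sub>0..<t]) (err x t\<^sub>0)"
  using assms(3)
proof (induction t rule: dec_induct)
  case (step t)
  then show ?case
    using assms(2) by (simp add: trajectory_iff[OF assms(1)])
qed simp

lemma err_ball_states_iff:
  assumes "err x t \<in> states"
  shows "err x t \<in> ball_states B \<longleftrightarrow> (MAX i\<in>{1..m}. norm (x i t - xs)) \<le> B"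
proof -
  have V: "finite ((\<lambda>i. norm (x i t - xs)) ` {1..m})" "(\<lambda>i. norm (x i t - xs)) ` {1..m} \<noteq> {}"
    using m by auto
  have "(\<forall>i. norm (err x t i) \<le> B) \<longleftrightarrow> (\<forall>i\<in>{1..m}. norm (x i t - xs) \<le> B)"
  proof
    assume *: "\<forall>i\<in>{1..m}. norm (x i t - xs) \<le> B"
    have "norm (x 1 t - xs) \<le> B"
      using * m by auto
    then have "0 \<le> B"
      using norm_ge_zero order_trans by blast
    with * show "\<forall>i. norm (err x t i) \<le> B"
      by (simp add: err_def)
  next
    assume *: "\<forall>i. norm (err x t i) \<le> B"
    show "\<forall>i\<in>{1..m}. norm (x i t - xs) \<le> B"
    proof
      fix i
      assume "i \<in> {1..m}"
      then show "norm (x i t - xs) \<le> B"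
        using *[rule_format, of i] by (simp add: err_def)
    qed
  qed
  then show ?thesis
    using assms unfolding Max_le_iff[OF V] ball_states_def by simp
qed

lemma converges_if_repeatedly_jointly_D_connected:
  assumes "repeatedly_jointly_D_connected m kern N"
  shows "\<exists>lam. 0 \<le> lam \<and> lam < 1 \<and> converges_at_rate m A b N xs lam"
proof -
  from exponential_decay[OF N_on N_self assms] obtain c lam
    where c: "0 < c" and lam: "0 \<le> lam" "lam < 1"
      and decay: "\<And>t\<^sub>0 t B y. 1 \<le> t\<^sub>0 \<Longrightarrow> t\<^sub>0 \<le> t \<Longrightarrow> y \<in> ball_states B \<Longrightarrow>
        run (map N [t\<^sub>0..<t]) y \<in> ball_states (c * lam ^ (t - t\<^sub>0) * B)"
    by blast
  have "(MAX i\<in>{1..m}. norm (x i t - xs))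
      \<le> c * lam ^ (t - t\<^sub>0) * (MAX i\<in>{1..m}. norm (x i t\<^sub>0 - xs))"
    if t0: "1 \<le> t\<^sub>0" and x: "trajectory m A b N t\<^sub>0 x" and t: "t\<^sub>0 \<le> t" for t\<^sub>0 t x
  proof -
    have "err x t\<^sub>0 \<in> states"
      using x unfolding trajectory_iff[OF t0] by (rule conjunct1)
    then have "err x t\<^sub>0 \<in> ball_states (MAX i\<in>{1..m}. norm (x i t\<^sub>0 - xs))"
      by (simp only: err_ball_states_iff order_refl)
    from decay[OF t0 t this] have ball: "err x t \<in> ball_states
        (c * lam ^ (t - t\<^sub>0) * (MAX i\<in>{1..m}. norm (x i t\<^sub>0 - xs)))"
      unfolding trajectory_imp_err_run[OF t0 x t] .
    then have "err x t \<in> states"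
      unfolding ball_states_def by blast
    from ball show ?thesis
      unfolding err_ball_states_iff[OF \<open>err x t \<in> states\<close>] .
  qed
  then have "converges_at_rate m A b N xs lam"
    unfolding converges_at_rate_def using c by blast
  with lam show ?thesis
    by blast
qed

text \<open>
  Windows of a length \<open>l\<close> with \<open>c * lam ^ l < 1\<close> work: a stationary error of norm \<open>|v|\<close> on such a
  window would have to shrink below \<open>|v|\<close>. Uniformity of \<open>c\<close> in the starting time is essential,
  as the windows start arbitrarily late.
\<close>

lemma repeatedly_jointly_D_connected_if_converges:
  assumes lam: "0 \<le> lam" "lam < 1" and "converges_at_rate m A b N xs lam"
  shows "repeatedly_jointly_D_connected m kern N"
proof -
  obtain c where c: "0 < c"
    and rate: "\<And>t\<^sub>0 t x. 1 \<le> t\<^sub>0 \<Longrightarrow> trajectory m A b N t\<^sub>0 x \<Longrightarrow> t\<^sub>0 \<le> t \<Longrightarrow>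
      (MAX i\<in>{1..m}. norm (x i t - xs))
        \<le> c * lam ^ (t - t\<^sub>0) * (MAX i\<in>{1..m}. norm (x i t\<^sub>0 - xs))"
    using assms(3) unfolding converges_at_rate_def by blast
  obtain k where k: "lam ^ k < 1 / c"
    using real_arch_pow_inv[of "1 / c" lam] lam c by auto
  define l where "l = Suc k"
  have "lam ^ l \<le> lam ^ k"
    unfolding l_def using lam by (intro power_decreasing) auto
  then have "lam ^ l < 1 / c"
    using k by (rule le_less_trans)
  then have l: "0 < l" "c * lam ^ l < 1"
    using c by (simp_all add: l_def field_simps)
  have "jointly_D_connected m kern (map N [t\<^sub>0..<t\<^sub>0 + l])" if t0: "1 \<le> t\<^sub>0" for t\<^sub>0
  proof (rule ccontr)
    let ?Gs = "map N [t\<^sub>0..<t\<^sub>0 + l]"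
    have "\<forall>G\<in>set ?Gs. digraph_on m G \<and> self_arcs m G"
      using N_on N_self t0 by auto
    moreover assume "\<not> jointly_D_connected m kern ?Gs"
    ultimately obtain y v i where v: "v \<noteq> 0" and y: "y \<in> ball_states (norm v)"
      and i: "i \<in> {1..m}" "run ?Gs y i = v"
      unfolding jointly_D_connected_def by (rule not_D_connected_imp_stationary_error)
    define x where "x i t = xs + run (map N [t\<^sub>0..<t]) y i" for i t
    have ball: "run (map N [t\<^sub>0..<t]) y \<in> ball_states (norm v)" for t
      using y N_on t0 by (intro run_ball_states) auto
    then have err: "err x t = run (map N [t\<^sub>0..<t]) y" for t
      by (auto simp: fun_eq_iff err_def x_def ball_states_def states_def)
    have st: "err x t \<in> states" and ball': "err x t \<in> ball_states (norm v)" for t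
      using ball[of t] unfolding err ball_states_def by auto
    have "trajectory m A b N t\<^sub>0 x"
      using st[of t\<^sub>0] unfolding trajectory_iff[OF t0] by (simp add: err)
    from rate[OF t0 this, of "t\<^sub>0 + l"]
    have "(MAX i\<in>{1..m}. norm (x i (t\<^sub>0 + l) - xs))
        \<le> c * lam ^ l * (MAX i\<in>{1..m}. norm (x i t\<^sub>0 - xs))"
      by simp
    also have "\<dots> \<le> c * lam ^ l * norm v"
      using ball'[of t\<^sub>0] c lam unfolding err_ball_states_iff[OF st]
      by (intro mult_left_mono) auto
    also have "\<dots> < norm v"
      using l v by simp
    finally have lt: "(MAX i\<in>{1..m}. norm (x i (t\<^sub>0 + l) - xs)) < norm v" .
    have "norm v = norm (x i (t\<^sub>0 + l) - xs)"
      using i(2) by (simp add: x_def)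
    also have "\<dots> \<le> (MAX i\<in>{1..m}. norm (x i (t\<^sub>0 + l) - xs))"
      using i(1) by (intro Max_ge) auto
    finally show False
      using lt by simp
  qed
  from this[of "1 + k * l" for k]
  have "jointly_D_connected m kern (map N [1 + k * l..<1 + (k + 1) * l])" for k
    by (simp add: algebra_simps)
  then show ?thesis
    unfolding repeatedly_jointly_D_connected_def using l(1)
    by (intro exI[of _ l] exI[of _ 1]) auto
qed

end

theorem theorem1:
  fixes m :: nat
    and r :: "nat \<Rightarrow> nat"
    and A :: "nat \<Rightarrow> 'n::finite row_mat"
    and b :: "nat \<Rightarrow> real list"
    and xs :: "real ^ 'n"
    and N :: "nat \<Rightarrow> digraph"
  assumes "m > 1"
    and "\<And>i. i \<in> {1..m} \<Longrightarrow> length (A i) = r i"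
    and "\<And>i. i \<in> {1..m} \<Longrightarrow> length (b i) = r i"
    and "\<exists>!x. row_mat_vec (stack m A) x = stack m b"
    and "row_mat_vec (stack m A) xs = stack m b"
    and "\<And>t. t \<ge> 1 \<Longrightarrow> digraph_on m (N t)"
    and "\<And>t. t \<ge> 1 \<Longrightarrow> self_arcs m (N t)"
  shows "(\<exists>lam. 0 \<le> lam \<and> lam < 1 \<and> converges_at_rate m A b N xs lam) \<longleftrightarrow>
    repeatedly_jointly_D_connected m (\<lambda>i. row_mat_kernel (A i)) N"
proof -
  interpret distributed_system m A b xs N
    using assms by unfold_locales simp_all
  show ?thesis
    using converges_if_repeatedly_jointly_D_connected repeatedly_jointly_D_connected_if_converges
    by blast
qed

end
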